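(* The tensor commutation matrix $U_{3\otimes 2}$ is expressed in terms of the Gell-Mann matrices $\lambda_1,\ldots,\lambda_8$ and the Pauli matrices $\sigma_1,\sigma_2,\sigma_3$ by $$\begin{aligned} U_{3\otimes 2}={}&\left(\tfrac13 I_3+\tfrac12\lambda_3+\tfrac{\sqrt3}{6}\lambda_8\right)\otimes\left(\tfrac12 I_2+\tfrac12\sigma_3\right) +\left(\tfrac12\lambda_1+\tfrac{i}{2}\lambda_2\right)\otimes\left(\tfrac12\sigma_1-\tfrac{i}{2}\sigma_2\right)\\ &+\left(\tfrac12\lambda_6+\tfrac{i}{2}\lambda_7\right)\otimes\left(\tfrac12 I_2+\tfrac12\sigma_3\right) +\left(\tfrac12\lambda_1-\tfrac{i}{2}\lambda_2\right)\otimes\left(\tfrac12 I_2-\tfrac12\sigma_3\right)\\ &+\left(\tfrac12\lambda_6-\tfrac{i}{2}\lambda_7\right)\otimes\left(\tfrac12\sigma_1+\tfrac{i}{2}\sigma_2\right) +\left(\tfrac13 I_3-\tfrac{\sqrt3}{3}\lambda_8\right)\otimes\left(\tfrac12 I_2-\tfrac12\sigma_3\right). \end{aligned}$$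
   Context: $\mathcal{M}_{m\times n}(\mathbb{C})$ denotes the set of $m\times n$ complex matrices, $I_n$ is the $n\times n$ identity matrix, and $i$ is the imaginary unit. For $A=(A^k_l)\in\mathcal{M}_{m\times n}(\mathbb{C})$ and $B\in\mathcal{M}_{p\times r}(\mathbb{C})$, the tensor product $A\otimes B\in\mathcal{M}_{mp\times nr}(\mathbb{C})$ is the Kronecker product, i.e. the block matrix whose $(k,l)$ block is $A^k_lB$. Matrices are identified when they agree as ordinary matrices after ignoring the block structure. For integers $p,q\geq 2$, the tensor commutation matrix $p\otimes q$ is the permutation matrix $U_{p\otimes q}\in\mathcal{M}_{pq\times pq}(\mathbb{C})$ (with entries 0 and 1) such that $U_{p\otimes q}\cdot(a\otimes b)=b\otimes a$ for all $a\in\mathcal{M}_{p\times 1}(\mathbb{C})$ and $b\in\mathcal{M}_{q\times 1}(\mathbb{C})$. Pauli matrices: $\sigma_1=\begin{pmatrix}0&1\\1&0\end{pmatrix}$, $\sigma_2=\begin{pmatrix}0&-i\\i&0\end{pmatrix}$, $\sigma_3=\begin{pmatrix}1&0\\0&-1\end{pmatrix}$. Gell-Mann matrices: $\lambda_1=\begin{pmatrix}0&1&0\\1&0&0\\0&0&0\end{pmatrix}$, $\lambda_2=\begin{pmatrix}0&-i&0\\i&0&0\\0&0&0\end{pmatrix}$, $\lambda_3=\begin{pmatrix}1&0&0\\0&-1&0\\0&0&0\end{pmatrix}$, $\lambda_4=\begin{pmatrix}0&0&1\\0&0&0\\1&0&0\end{pmatrix}$, $\lambda_5=\begin{pmatrix}0&0&-i\\0&0&0\\i&0&0\end{pmatrix}$,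 $\lambda_6=\begin{pmatrix}0&0&0\\0&0&1\\0&1&0\end{pmatrix}$, $\lambda_7=\begin{pmatrix}0&0&0\\0&0&-i\\0&i&0\end{pmatrix}$, $\lambda_8=\frac{1}{\sqrt3}\begin{pmatrix}1&0&0\\0&1&0\\0&0&-2\end{pmatrix}$. *)

theory Defs
  imports Complex_Main "Jordan_Normal_Form.Matrix"
begin

text \<open>Rows and columns are indexed from 0. The row index \<open>i\<close> of the product stands for row
  \<open>i mod dim_row B\<close> inside block row \<open>i div dim_row B\<close>, and likewise for columns.\<close>

definition tensor_mat :: "complex mat \<Rightarrow> complex mat \<Rightarrow> complex mat"  (infixl \<open>\<Otimes>\<close> 70) where
  "A \<Otimes> B = mat (dim_row A * dim_row B) (dim_col A * dim_col B)
     (\<lambda>(i, j). A $$ (i div dim_row B, j div dim_col B) * B $$ (i mod dim_row B, j mod dim_col B))"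

definition permutation_matrix :: "nat \<Rightarrow> complex mat \<Rightarrow> bool" where
  "permutation_matrix n U \<longleftrightarrow>
     U \<in> carrier_mat n n \<and>
     (\<forall>i<n. \<forall>j<n. U $$ (i, j) \<in> {0, 1}) \<and>
     (\<forall>i<n. \<exists>!j. j < n \<and> U $$ (i, j) = 1) \<and>
     (\<forall>j<n. \<exists>!i. i < n \<and> U $$ (i, j) = 1)"

definition is_tensor_commutation_matrix :: "nat \<Rightarrow> nat \<Rightarrow> complex mat \<Rightarrow> bool" where
  "is_tensor_commutation_matrix p q U \<longleftrightarrow>
     permutation_matrix (p * q) U \<and>
     (\<forall>a \<in> carrier_mat p 1. \<forall>b \<in> carrier_mat q 1. U * (a \<Otimes> b) = b \<Otimes> a)"

definition tensor_commutation_matrix :: "nat \<Rightarrow> nat \<Rightarrow> complex mat" where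
  "tensor_commutation_matrix p q = (THE U. is_tensor_commutation_matrix p q U)"

text \<open>The defining property determines the matrix: there is exactly one such \<open>U\<close>.\<close>

lemma swap_index:
  fixes p q r :: nat
  assumes "r < p * q"
  shows "(r mod p) * q + r div p < p * q"
    and "((r mod p) * q + r div p) div q = r mod p"
    and "((r mod p) * q + r div p) mod q = r div p"
proof -
  have "p > 0" using assms by (cases p) auto
  then have a: "r mod p < p" by simp
  have b: "r div p < q" using assms by (simp add: less_mult_imp_div_less mult.commute)
  have "(r mod p) * q + r div p < (r mod p) * q + q" using b by simp
  also have "\<dots> = Suc (r mod p) * q" by simp
  also have "\<dots> \<le> p * q" using a by (intro mult_le_mono1) simp
  finally show "(r mod p) * q + r div p < p * q" .
  show "((r mod p) * q + r div p) div q = r mod p" using b by simp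
  show "((r mod p) * q + r div p) mod q = r div p" using b by simp
qed

lemma swap_index_iff:
  fixes p q r c :: nat
  assumes "r < p * q" and "c < p * q"
  shows "c = (r mod p) * q + r div p \<longleftrightarrow> r = (c mod q) * p + c div q"
  using swap_index[of r p q] swap_index[of c q p] assms
  by (metis mult.commute div_mult_mod_eq)

lemma tensor_commutation_matrix_exists:
  "is_tensor_commutation_matrix p q
     (mat (p * q) (p * q) (\<lambda>(r, c). if c = (r mod p) * q + r div p then 1 else 0))"
  (is "is_tensor_commutation_matrix p q ?U")
  unfolding is_tensor_commutation_matrix_def
proof (intro conjI ballI)
  show "permutation_matrix (p * q) ?U"
    unfolding permutation_matrix_def
  proof (intro conjI allI impI)
    fix i assume i: "i < p * q"
    show "\<exists>!j. j < p * q \<and> ?U $$ (i, j) = 1"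
      by (rule ex1I[of _ "(i mod p) * q + i div p"])
        (use i swap_index(1)[OF i] in \<open>auto split: if_splits\<close>)
  next
    fix j assume j: "j < p * q"
    have j': "(j mod q) * p + j div q < p * q"
      using swap_index(1)[of j q p] j by (simp add: mult.commute)
    show "\<exists>!i. i < p * q \<and> ?U $$ (i, j) = 1"
    proof (rule ex1I[of _ "(j mod q) * p + j div q"])
      show "(j mod q) * p + j div q < p * q \<and> ?U $$ ((j mod q) * p + j div q, j) = 1"
        using j j' swap_index_iff[OF j' j] by simp
    next
      fix i assume "i < p * q \<and> ?U $$ (i, j) = 1"
      then show "i = (j mod q) * p + j div q"
        using j swap_index_iff[of i p q j] by (auto split: if_splits)
    qed
  qed auto
next
  fix a b :: "complex mat"
  assume a: "a \<in> carrier_mat p 1" and b: "b \<in> carrier_mat q 1"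
  show "?U * (a \<Otimes> b) = b \<Otimes> a"
  proof (rule eq_matI)
    fix r c assume "r < dim_row (b \<Otimes> a)" and "c < dim_col (b \<Otimes> a)"
    then have r: "r < p * q" and c: "c = 0"
      using a b by (auto simp: tensor_mat_def mult.commute)
    let ?k = "(r mod p) * q + r div p"
    have "(?U * (a \<Otimes> b)) $$ (r, c)
        = (\<Sum>k = 0..<p * q. (if k = ?k then 1 else 0) * (a \<Otimes> b) $$ (k, 0))"
      using r c a b by (auto simp: scalar_prod_def tensor_mat_def intro!: sum.cong)
    also have "\<dots> = (\<Sum>k = 0..<p * q. if k = ?k then (a \<Otimes> b) $$ (k, 0) else 0)"
      by (intro sum.cong) auto
    also have "\<dots> = (a \<Otimes> b) $$ (?k, 0)"
      using swap_index(1)[OF r] by (simp add: sum.delta)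
    also have "\<dots> = a $$ (r mod p, 0) * b $$ (r div p, 0)"
      using swap_index[OF r] a b by (simp add: tensor_mat_def)
    also have "\<dots> = (b \<Otimes> a) $$ (r, c)"
      using r c a b by (simp add: tensor_mat_def mult.commute)
    finally show "(?U * (a \<Otimes> b)) $$ (r, c) = (b \<Otimes> a) $$ (r, c)" .
  qed (use a b in \<open>auto simp: tensor_mat_def\<close>)
qed

lemma tensor_commutation_matrix_unique:
  assumes U: "is_tensor_commutation_matrix p q U" and V: "is_tensor_commutation_matrix p q V"
  shows "U = V"
proof (rule eq_matI)
  have cU: "U \<in> carrier_mat (p * q) (p * q)" and cV: "V \<in> carrier_mat (p * q) (p * q)"
    using U V by (auto simp: is_tensor_commutation_matrix_def permutation_matrix_def)
  show "dim_row U = dim_row V" "dim_col U = dim_col V" using cU cV by auto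
  fix r c assume "r < dim_row V" "c < dim_col V"
  then have r: "r < p * q" and c: "c < p * q" using cV by auto
  define a :: "complex mat" where "a = mat p 1 (\<lambda>(k, _). if k = c div q then 1 else 0)"
  define b :: "complex mat" where "b = mat q 1 (\<lambda>(k, _). if k = c mod q then 1 else 0)"
  have q: "q > 0" using c by (cases q) auto
  have ab: "(a \<Otimes> b) $$ (k, 0) = (if k = c then 1 else 0)" if "k < p * q" for k
  proof -
    have "k div q = c div q \<and> k mod q = c mod q \<longleftrightarrow> k = c"
      by (metis div_mult_mod_eq)
    then show ?thesis
      using that q by (auto simp: a_def b_def tensor_mat_def less_mult_imp_div_less)
  qed
  have col: "(W * (a \<Otimes> b)) $$ (r, 0) = W $$ (r, c)"
    if W: "W \<in> carrier_mat (p * q) (p * q)" for W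
  proof -
    have "(W * (a \<Otimes> b)) $$ (r, 0) = (\<Sum>k = 0..<p * q. W $$ (r, k) * (a \<Otimes> b) $$ (k, 0))"
      using W r by (auto simp: scalar_prod_def a_def b_def tensor_mat_def intro!: sum.cong)
    also have "\<dots> = (\<Sum>k = 0..<p * q. if k = c then W $$ (r, k) else 0)"
      by (intro sum.cong) (auto simp: ab)
    finally show ?thesis using c by (simp add: sum.delta)
  qed
  have "a \<in> carrier_mat p 1" "b \<in> carrier_mat q 1" by (auto simp: a_def b_def)
  then have "U * (a \<Otimes> b) = V * (a \<Otimes> b)"
    using U V by (simp add: is_tensor_commutation_matrix_def)
  then show "U $$ (r, c) = V $$ (r, c)" using col[OF cU] col[OF cV] by simp
qed

lemma ex1_tensor_commutation_matrix: "\<exists>!U. is_tensor_commutation_matrix p q U"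
  using tensor_commutation_matrix_exists tensor_commutation_matrix_unique by blast

definition pauli1 :: "complex mat"  (\<open>\<sigma>\<^sub>1\<close>) where
  "\<sigma>\<^sub>1 = mat_of_rows_list 2 [[0, 1], [1, 0]]"

definition pauli2 :: "complex mat"  (\<open>\<sigma>\<^sub>2\<close>) where
  "\<sigma>\<^sub>2 = mat_of_rows_list 2 [[0, - \<i>], [\<i>, 0]]"

definition pauli3 :: "complex mat"  (\<open>\<sigma>\<^sub>3\<close>) where
  "\<sigma>\<^sub>3 = mat_of_rows_list 2 [[1, 0], [0, - 1]]"

definition gell_mann1 :: "complex mat"  (\<open>\<lambda>\<^sub>1\<close>) where
  "\<lambda>\<^sub>1 = mat_of_rows_list 3 [[0, 1, 0], [1, 0, 0], [0, 0, 0]]"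

definition gell_mann2 :: "complex mat"  (\<open>\<lambda>\<^sub>2\<close>) where
  "\<lambda>\<^sub>2 = mat_of_rows_list 3 [[0, - \<i>, 0], [\<i>, 0, 0], [0, 0, 0]]"

definition gell_mann3 :: "complex mat"  (\<open>\<lambda>\<^sub>3\<close>) where
  "\<lambda>\<^sub>3 = mat_of_rows_list 3 [[1, 0, 0], [0, - 1, 0], [0, 0, 0]]"

definition gell_mann4 :: "complex mat"  (\<open>\<lambda>\<^sub>4\<close>) where
  "\<lambda>\<^sub>4 = mat_of_rows_list 3 [[0, 0, 1], [0, 0, 0], [1, 0, 0]]"

definition gell_mann5 :: "complex mat"  (\<open>\<lambda>\<^sub>5\<close>) where
  "\<lambda>\<^sub>5 = mat_of_rows_list 3 [[0, 0, - \<i>], [0, 0, 0], [\<i>, 0, 0]]"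

definition gell_mann6 :: "complex mat"  (\<open>\<lambda>\<^sub>6\<close>) where
  "\<lambda>\<^sub>6 = mat_of_rows_list 3 [[0, 0, 0], [0, 0, 1], [0, 1, 0]]"

definition gell_mann7 :: "complex mat"  (\<open>\<lambda>\<^sub>7\<close>) where
  "\<lambda>\<^sub>7 = mat_of_rows_list 3 [[0, 0, 0], [0, 0, - \<i>], [0, \<i>, 0]]"

definition gell_mann8 :: "complex mat"  (\<open>\<lambda>\<^sub>8\<close>) where
  "\<lambda>\<^sub>8 = complex_of_real (1 / sqrt 3) \<cdot>\<^sub>m mat_of_rows_list 3 [[1, 0, 0], [0, 1, 0], [0, 0, - 2]]"

end

(* Each factor on the right-hand side is a matrix unit, and the Kronecker product of two matrix
  units is a matrix unit. The six summands thus become the six nonzero entries of the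
  permutation matrix. *)

theory Submission
  imports Defs
begin

definition matrix_unit :: "nat \<Rightarrow> nat \<Rightarrow> nat \<Rightarrow> complex mat" where
  "matrix_unit n k l = mat n n (\<lambda>(i, j). if i = k \<and> j = l then 1 else 0)"

text \<open>An entry on the left tests quotient and remainder modulo \<open>q\<close> of each index.
  By uniqueness of division with remainder (\<open>digits\<close>) this is a single test on each
  index. If \<open>k\<close> or \<open>l\<close> is at least \<open>p\<close>, both sides are the
  zero matrix.\<close>

lemma tensor_matrix_unit:
  assumes "k' < q" "l' < q"
  shows "matrix_unit p k l \<Otimes> matrix_unit q k' l' = matrix_unit (p * q) (k * q + k') (l * q + l')"
proof (rule eq_matI)
  have digits: "i div q = m \<and> i mod q = m' \<longleftrightarrow> i = m * q + m'" if "m' < q" for i m m'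
    using that by (metis add.commute div_mult_mod_eq div_mult_self3 div_less add.right_neutral
        mod_mult_self3 mod_less less_nat_zero_code)
  fix i j
  assume "i < dim_row (matrix_unit (p * q) (k * q + k') (l * q + l'))"
    and "j < dim_col (matrix_unit (p * q) (k * q + k') (l * q + l'))"
  then show "(matrix_unit p k l \<Otimes> matrix_unit q k' l') $$ (i, j)
      = matrix_unit (p * q) (k * q + k') (l * q + l') $$ (i, j)"
    using assms digits[of k' i k] digits[of l' j l]
    by (auto simp: matrix_unit_def tensor_mat_def less_mult_imp_div_less)
qed (simp_all add: matrix_unit_def tensor_mat_def)

lemma less_2_iff: "i < 2 \<longleftrightarrow> i = 0 \<or> i = 1" for i :: nat
  by auto

lemma less_3_iff: "i < 3 \<longleftrightarrow> i = 0 \<or> i = 1 \<or> i = 2" for i :: nat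
  by auto

lemma less_6_iff: "i < 6 \<longleftrightarrow> i = 0 \<or> i = 1 \<or> i = 2 \<or> i = 3 \<or> i = 4 \<or> i = 5" for i :: nat
  by auto

text \<open>Serves to cancel the factor \<open>1 / sqrt 3\<close> of
  \<open>\<lambda>\<^sub>8\<close> against its coefficients \<open>sqrt 3 / 6\<close> and
  \<open>sqrt 3 / 3\<close>.\<close>

lemma sqrt3_sqrt3: "complex_of_real (sqrt 3) * complex_of_real (sqrt 3) = 3"
  by (simp flip: of_real_mult)

text \<open>Multiplying \<open>\<sigma>\<^sub>2\<close> by \<open>\<i>\<close> gives the real matrix
  with rows (0, 1) and (-1, 0), so adding it to or subtracting it from
  \<open>\<sigma>\<^sub>1\<close> kills one off-diagonal entry and doubles the other.\<close>

lemma pauli_matrix_units: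
  "(1 / 2) \<cdot>\<^sub>m 1\<^sub>m 2 + (1 / 2) \<cdot>\<^sub>m \<sigma>\<^sub>3 = matrix_unit 2 0 0"
  "(1 / 2) \<cdot>\<^sub>m \<sigma>\<^sub>1 + (\<i> / 2) \<cdot>\<^sub>m \<sigma>\<^sub>2 = matrix_unit 2 0 1"
  "(1 / 2) \<cdot>\<^sub>m \<sigma>\<^sub>1 - (\<i> / 2) \<cdot>\<^sub>m \<sigma>\<^sub>2 = matrix_unit 2 1 0"
  "(1 / 2) \<cdot>\<^sub>m 1\<^sub>m 2 - (1 / 2) \<cdot>\<^sub>m \<sigma>\<^sub>3 = matrix_unit 2 1 1"
  by (rule eq_matI; auto simp: matrix_unit_def pauli1_def pauli2_def pauli3_def
      mat_of_rows_list_def less_2_iff)+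

text \<open>The off-diagonal cases repeat the Pauli computation inside a 2 by 2 block. For the
  diagonal ones, \<open>sqrt 3 / 6\<close> times \<open>\<lambda>\<^sub>8\<close> is diag(1/6, 1/6,
  -1/3), and \<open>sqrt 3 / 3\<close> times it is twice that.\<close>

lemma gell_mann_matrix_units:
  "(1 / 3) \<cdot>\<^sub>m 1\<^sub>m 3 + (1 / 2) \<cdot>\<^sub>m \<lambda>\<^sub>3 + complex_of_real (sqrt 3 / 6) \<cdot>\<^sub>m \<lambda>\<^sub>8 = matrix_unit 3 0 0"
  "(1 / 2) \<cdot>\<^sub>m \<lambda>\<^sub>1 + (\<i> / 2) \<cdot>\<^sub>m \<lambda>\<^sub>2 = matrix_unit 3 0 1"
  "(1 / 2) \<cdot>\<^sub>m \<lambda>\<^sub>1 - (\<i> / 2) \<cdot>\<^sub>m \<lambda>\<^sub>2 = matrix_unit 3 1 0"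
  "(1 / 2) \<cdot>\<^sub>m \<lambda>\<^sub>6 + (\<i> / 2) \<cdot>\<^sub>m \<lambda>\<^sub>7 = matrix_unit 3 1 2"
  "(1 / 2) \<cdot>\<^sub>m \<lambda>\<^sub>6 - (\<i> / 2) \<cdot>\<^sub>m \<lambda>\<^sub>7 = matrix_unit 3 2 1"
  "(1 / 3) \<cdot>\<^sub>m 1\<^sub>m 3 - complex_of_real (sqrt 3 / 3) \<cdot>\<^sub>m \<lambda>\<^sub>8 = matrix_unit 3 2 2"
  by (rule eq_matI; auto simp: matrix_unit_def gell_mann1_def gell_mann2_def gell_mann3_def
      gell_mann6_def gell_mann7_def gell_mann8_def mat_of_rows_list_def less_3_iff
      numeral_2_eq_2 sqrt3_sqrt3 field_simps)+

theorem mainTheorem2: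
  shows "tensor_commutation_matrix 3 2 =
       ((1 / 3) \<cdot>\<^sub>m 1\<^sub>m 3 + (1 / 2) \<cdot>\<^sub>m \<lambda>\<^sub>3 + complex_of_real (sqrt 3 / 6) \<cdot>\<^sub>m \<lambda>\<^sub>8)
         \<Otimes> ((1 / 2) \<cdot>\<^sub>m 1\<^sub>m 2 + (1 / 2) \<cdot>\<^sub>m \<sigma>\<^sub>3)
     + ((1 / 2) \<cdot>\<^sub>m \<lambda>\<^sub>1 + (\<i> / 2) \<cdot>\<^sub>m \<lambda>\<^sub>2)
         \<Otimes> ((1 / 2) \<cdot>\<^sub>m \<sigma>\<^sub>1 - (\<i> / 2) \<cdot>\<^sub>m \<sigma>\<^sub>2)
     + ((1 / 2) \<cdot>\<^sub>m \<lambda>\<^sub>6 + (\<i> / 2) \<cdot>\<^sub>m \<lambda>\<^sub>7)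
         \<Otimes> ((1 / 2) \<cdot>\<^sub>m 1\<^sub>m 2 + (1 / 2) \<cdot>\<^sub>m \<sigma>\<^sub>3)
     + ((1 / 2) \<cdot>\<^sub>m \<lambda>\<^sub>1 - (\<i> / 2) \<cdot>\<^sub>m \<lambda>\<^sub>2)
         \<Otimes> ((1 / 2) \<cdot>\<^sub>m 1\<^sub>m 2 - (1 / 2) \<cdot>\<^sub>m \<sigma>\<^sub>3)
     + ((1 / 2) \<cdot>\<^sub>m \<lambda>\<^sub>6 - (\<i> / 2) \<cdot>\<^sub>m \<lambda>\<^sub>7)
         \<Otimes> ((1 / 2) \<cdot>\<^sub>m \<sigma>\<^sub>1 + (\<i> / 2) \<cdot>\<^sub>m \<sigma>\<^sub>2)
     + ((1 / 3) \<cdot>\<^sub>m 1\<^sub>m 3 - complex_of_real (sqrt 3 / 3) \<cdot>\<^sub>m \<lambda>\<^sub>8)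
         \<Otimes> ((1 / 2) \<cdot>\<^sub>m 1\<^sub>m 2 - (1 / 2) \<cdot>\<^sub>m \<sigma>\<^sub>3)"
proof -
  have "tensor_commutation_matrix 3 2
      = mat 6 6 (\<lambda>(r, c). if c = (r mod 3) * 2 + r div 3 then 1 else 0)"
    unfolding tensor_commutation_matrix_def
    \<comment> \<open>Uniqueness lets the definite description be replaced by the explicit witness
      of the existence lemma.\<close>
    by (rule the1_equality[OF ex1_tensor_commutation_matrix])
      (use tensor_commutation_matrix_exists[of 3 2] in simp)
  \<comment> \<open>Rows 0 to 5 have their 1 in columns 0, 2, 4, 1, 3, 5. Listing them by row
    matches the order of the summands in the claim.\<close>
  also have "\<dots> = matrix_unit 6 0 0 + matrix_unit 6 1 2 + matrix_unit 6 2 4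
      + matrix_unit 6 3 1 + matrix_unit 6 4 3 + matrix_unit 6 5 5"
    by (rule eq_matI) (auto simp: matrix_unit_def less_6_iff)
  finally show ?thesis
    \<comment> \<open>For instance, the second summand has factors with units (0, 1) and (1, 0), so
      its unit is at row 0 * 2 + 1 = 1 and column 1 * 2 + 0 = 2.\<close>
    unfolding pauli_matrix_units gell_mann_matrix_units by (simp add: tensor_matrix_unit)
qed

end
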